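(* Let $k\ge 2$ be an integer, and let $\beta_k^{+}$, $\beta_k^{-}$ be the quantities defined in the context. (i) (Nonnegative case.) If $M$ is a $4\times 4$ unimodular matrix all of whose entries lie in $\{0,1,\dots,k\}$ and $A$ is any $3\times 3$ submatrix of $M$ (obtained by deleting one row and one column), then $$|\det A|\ \le\ \beta_k^{+}=k(2k^2-2k+1)=2k^3-2k^2+k.$$ (ii) (Signed case.) If $M$ is a $4\times 4$ unimodular matrix all of whose entries lie in $\{-k,\dots,-1,0,1,\dots,k\}$ and $A$ is any $3\times 3$ submatrix of $M$ (obtained by deleting one row and one column), then $$|\det A|\ \le\ \beta_k^{-}=k(2k-1)(2k+1)=4k^3-k.$$ Both bounds are attained for every $k\ge 2$: in each case there exist a $4\times4$ unimodular matrix $M$ with entries in the indicated set and a $3\times 3$ submatrix $A$ of $M$ for which equality holds.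
   Context: An $n\times n$ integer matrix is called unimodular if its determinant is $\pm1$. For a matrix $X$, $\|X\|$ denotes the maximum absolute value of its entries. Define $\beta_k^{-}$ as the maximum of $\|M^{-1}\|$ over all unimodular $M\in\mathbb{Z}^{4\times 4}$ with $\|M\|=k$, and $\beta_k^{+}$ as the maximum of $\|M^{-1}\|$ over all unimodular $M\in\mathbb{Z}_{\ge 0}^{4\times 4}$ (nonnegative integer entries) with $\|M\|=k$. *)

theory Defs
  imports "Jordan_Normal_Form.Determinant"
begin

definition unimodular :: "int mat \<Rightarrow> bool" where
  "unimodular M \<longleftrightarrow> square_mat M \<and> (det M = 1 \<or> det M = -1)"

definition max_norm :: "int mat \<Rightarrow> int" where
  "max_norm X = Max (abs ` elements_mat X)"

(* The inverse is taken over the integers: it exists for every unimodular matrix and is then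
   also the rational inverse. The two conditions force the dimensions of B when M is square,
   so B is unique. *)
definition int_mat_inv :: "int mat \<Rightarrow> int mat" where
  "int_mat_inv M = (THE B. inverts_mat M B \<and> inverts_mat B M)"

(* In both definitions the maximum ranges over a finite set, since the entries of M are bounded. *)
definition beta_minus :: "int \<Rightarrow> int" where
  "beta_minus k = Max {max_norm (int_mat_inv M) | M.
     M \<in> carrier_mat 4 4 \<and> unimodular M \<and> max_norm M = k}"

definition beta_plus :: "int \<Rightarrow> int" where
  "beta_plus k = Max {max_norm (int_mat_inv M) | M.
     M \<in> carrier_mat 4 4 \<and> unimodular M \<and> elements_mat M \<subseteq> {0..} \<and> max_norm M = k}"

end

theory Submission
  imports Defs
begin

text \<open>
  For a unimodular \<open>M\<close> the inverse is \<open>\<plusminus>\<close> the adjugate, so the entries of the inverse are, up to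
  sign, exactly the \<open>3 \<times> 3\<close> minors of \<open>M\<close>. Both claims are thus about the largest possible minor.

  The Hadamard-type maxima of a \<open>3 \<times> 3\<close> determinant, \<open>2k\<^sup>3\<close> for entries in \<open>[0, k]\<close> and \<open>4k\<^sup>3\<close> for
  entries in \<open>[-k, k]\<close>, are attained at corners of the box, where all entries are divisible by
  \<open>k\<close>. Unimodularity excludes these corners and even their incident edges: if at most one entry
  of a \<open>3 \<times> 3\<close> submatrix \<open>A\<close> is not divisible by \<open>k\<close>, then \<open>A\<close> has two rows divisible by \<open>k\<close>, and
  the corresponding two rows of \<open>M\<close> are, modulo \<open>k\<close>, supported in the single column that \<open>A\<close>
  omits, which forces \<open>k\<close> to divide \<open>det M = \<plusminus>1\<close>. Hence two entries of \<open>A\<close> are indivisible by \<open>k\<close>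
  (\<open>exists_two_nondivisible_entries\<close>), and so lie strictly inside the box.

  What remains is an elementary estimate: with two entries at distance at least 1 from the end
  points of the interval, the determinant is at most \<open>k (2k\<^sup>2 - 2k + 1)\<close>, respectively
  \<open>k (4k\<^sup>2 - 1)\<close>, in absolute value. Up to permuting rows and
  columns and transposing, the two entries are either in one row or in different rows and
  columns. The second case gives the sharp bounds. The determinant is affine in each entry, so
  some entries may be pushed to end points; if the pivot \<open>i\<close> becomes \<open>\<plusminus>k\<close>, the identity
  \<open>i det A = (x i - c g) (y i - f h) - (b i - c h) (d i - f g)\<close> (\<open>det3_pivot\<close>) separates the two
  interior entries \<open>x, y\<close> into different factors and the bound can be read off.
  Explicit matrices (\<open>extremal_plus\<close>, \<open>extremal_minus\<close>) attain the bounds.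
\<close>

section \<open>Minors, inverses and divisibility\<close>

lemma abs_cofactor: "\<bar>cofactor M i j\<bar> = \<bar>det (mat_delete M i j)\<bar>" for M :: "int mat"
  by (simp add: cofactor_def abs_mult power_abs)

lemma int_mat_inv_eq_adj:
  assumes M: "M \<in> carrier_mat n n" and uni: "unimodular M"
  shows "int_mat_inv M = det M \<cdot>\<^sub>m adj_mat M"
proof -
  define B where "B = det M \<cdot>\<^sub>m adj_mat M"
  have sq: "det M * det M = 1" using uni by (auto simp: unimodular_def)
  have B: "B \<in> carrier_mat n n" using adj_mat(1)[OF M] by (simp add: B_def)
  have MB: "M * B = 1\<^sub>m n"
    unfolding B_def mult_smult_distrib[OF M adj_mat(1)[OF M]] adj_mat(2)[OF M]
    using sq by (intro eq_matI) auto
  have BM: "B * M = 1\<^sub>m n"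
    unfolding B_def mult_smult_assoc_mat[OF adj_mat(1)[OF M] M] adj_mat(3)[OF M]
    using sq by (intro eq_matI) auto
  have "int_mat_inv M = B" unfolding int_mat_inv_def
  proof (rule the_equality)
    show "inverts_mat M B \<and> inverts_mat B M"
      using MB BM M B by (simp add: inverts_mat_def)
  next
    \<comment> \<open>The dimensions of a two-sided inverse are not assumed; the two equations determine them.\<close>
    fix C assume C: "inverts_mat M C \<and> inverts_mat C M"
    have MC: "M * C = 1\<^sub>m n" and CM: "C * M = 1\<^sub>m (dim_row C)"
      using C M by (auto simp: inverts_mat_def)
    have "dim_col C = n" using arg_cong[OF MC, of dim_col] by simp
    moreover have "dim_row C = n" using arg_cong[OF CM, of dim_col] M by simp
    ultimately have Cc: "C \<in> carrier_mat n n" by auto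
    have "C = (B * M) * C" using BM Cc by simp
    also have "\<dots> = B * (M * C)" using B M Cc by simp
    also have "\<dots> = B" using MC B by simp
    finally show "C = B" .
  qed
  then show ?thesis by (simp add: B_def)
qed

lemma max_norm_int_mat_inv:
  assumes M: "M \<in> carrier_mat n n" and uni: "unimodular M"
  shows "max_norm (int_mat_inv M)
    = Max ((\<lambda>(i, j). \<bar>det (mat_delete M i j)\<bar>) ` ({..<n} \<times> {..<n}))"
proof -
  have d: "\<bar>det M\<bar> = 1" using uni by (auto simp: unimodular_def)
  have A: "int_mat_inv M \<in> carrier_mat n n"
    using adj_mat(1)[OF M] int_mat_inv_eq_adj[OF M uni] by simp
  have entry: "\<bar>int_mat_inv M $$ (j, i)\<bar> = \<bar>det (mat_delete M i j)\<bar>" if "i < n" "j < n" for i j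
    using that M d by (simp add: int_mat_inv_eq_adj[OF M uni] adj_mat_def abs_mult abs_cofactor)
  have "abs ` elements_mat (int_mat_inv M)
      = (\<lambda>(i, j). \<bar>det (mat_delete M i j)\<bar>) ` ({..<n} \<times> {..<n})" (is "?L = ?R")
  proof (intro equalityI subsetI)
    fix v assume "v \<in> ?L"
    then obtain i j where "i < n" "j < n" "v = \<bar>int_mat_inv M $$ (j, i)\<bar>"
      using A by (auto dest!: elements_matD)
    then show "v \<in> ?R" by (auto simp: entry intro!: image_eqI[of _ _ "(i, j)"])
  next
    fix v assume "v \<in> ?R"
    then obtain i j where "i < n" "j < n" "v = \<bar>int_mat_inv M $$ (j, i)\<bar>"
      by (auto simp: entry)
    then show "v \<in> ?L" using elements_matI[OF A] by blast
  qed
  then show ?thesis by (simp add: max_norm_def)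
qed

text \<open>Reduces the two maxima over inverses to a bound on minors and one witness; boundedness also gives
  finiteness of the set, without which \<open>Max\<close> would be meaningless.\<close>

lemma Max_max_norm_inverse:
  assumes P: "\<And>M. P M \<Longrightarrow> M \<in> carrier_mat n n \<and> unimodular M"
    and le: "\<And>M i j. P M \<Longrightarrow> i < n \<Longrightarrow> j < n \<Longrightarrow> \<bar>det (mat_delete M i j)\<bar> \<le> B"
    and W: "P W" "i < n" "j < n" "\<bar>det (mat_delete W i j)\<bar> = B"
  shows "Max {max_norm (int_mat_inv M) | M. P M} = B"
proof -
  have inv: "max_norm (int_mat_inv M) \<in> {0..B}" if "P M" for M
  proof -
    let ?S = "(\<lambda>(i, j). \<bar>det (mat_delete M i j)\<bar>) ` ({..<n} \<times> {..<n})"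
    have "Max ?S \<in> ?S" using W by (intro Max_in) auto
    then show ?thesis using max_norm_int_mat_inv[of M n] P[OF that] le[OF that] by auto
  qed
  let ?T = "(\<lambda>(i, j). \<bar>det (mat_delete W i j)\<bar>) ` ({..<n} \<times> {..<n})"
  have "B \<le> Max ?T" using W by (intro Max_ge) auto
  then have "max_norm (int_mat_inv W) = B"
    using max_norm_int_mat_inv[of W n] P[OF W(1)] inv[OF W(1)] by auto
  moreover have "finite {max_norm (int_mat_inv M) | M. P M}"
    by (rule finite_subset[of _ "{0..B}"]) (use inv in auto)
  ultimately show ?thesis using W(1) inv by (intro Max_eqI) auto
qed

lemma dvd_det_of_dvd_row:
  fixes M :: "int mat"
  assumes M: "M \<in> carrier_mat n n" and r: "r < n"
    and dvd: "\<And>c. c < n \<Longrightarrow> k dvd M $$ (r, c)"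
  shows "k dvd det M"
  unfolding laplace_expansion_row[OF M r] using dvd by (intro dvd_sum) auto

text \<open>Expanding along row \<open>r\<close>, only the term in column \<open>j\<close> can survive modulo \<open>k\<close>; but its
  cofactor still contains the row \<open>r'\<close> with column \<open>j\<close> removed, which vanishes modulo \<open>k\<close>.\<close>

lemma dvd_det_of_dvd_two_rows:
  fixes M :: "int mat"
  assumes M: "M \<in> carrier_mat n n" and j: "j < n"
    and rows: "r < n" "r' < n" "r \<noteq> r'"
    and dvd: "\<And>c. c < n \<Longrightarrow> c \<noteq> j \<Longrightarrow> k dvd M $$ (r, c)"
      "\<And>c. c < n \<Longrightarrow> c \<noteq> j \<Longrightarrow> k dvd M $$ (r', c)"
  shows "k dvd det M"
proof -
  obtain m where n: "n = Suc m" using j by (cases n) auto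
  let ?D = "mat_delete M r j"
  let ?s = "delete_index r r'"
  have s: "?s < m" and ins: "insert_index r ?s = r'"
    using rows n by (auto simp: delete_index_def insert_delete_index)
  have "k dvd det ?D"
  proof (rule dvd_det_of_dvd_row)
    show "?D \<in> carrier_mat m m" using mat_delete_carrier[OF M] n by simp
    fix c assume c: "c < m"
    have "?D $$ (?s, c) = M $$ (r', insert_index j c)"
      using mat_delete_index[of M m r j ?s c] M rows j s c ins n by simp
    moreover have "insert_index j c < n" "insert_index j c \<noteq> j"
      using c n by (auto simp: insert_index_def)
    ultimately show "k dvd ?D $$ (?s, c)" using dvd(2) by simp
  qed (fact s)
  then have "k dvd M $$ (r, c) * cofactor M r c" if "c < n" for c
    using dvd(1) that by (cases "c = j") (auto simp: cofactor_def)
  then show ?thesis unfolding laplace_expansion_row[OF M rows(1)] by (intro dvd_sum) auto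
qed

section \<open>Determinants of order three\<close>

definition det3 ::
    "int \<Rightarrow> int \<Rightarrow> int \<Rightarrow> int \<Rightarrow> int \<Rightarrow> int \<Rightarrow> int \<Rightarrow> int \<Rightarrow> int \<Rightarrow> int" where
  "det3 a b c d e f g h i = a * (e * i - f * h) - b * (d * i - f * g) + c * (d * h - e * g)"

lemma det_2:
  fixes A :: "int mat"
  assumes A: "A \<in> carrier_mat 2 2"
  shows "det A = A $$ (0, 0) * A $$ (1, 1) - A $$ (0, 1) * A $$ (1, 0)"
proof -
  have "{..<2::nat} = {0, 1}" by auto
  moreover have "det (mat_delete A 0 j) = mat_delete A 0 j $$ (0, 0)" for j
    using mat_delete_carrier[OF A, of 0 j] by (intro det_single) simp
  ultimately have "det A = A $$ (0, 0) * mat_delete A 0 0 $$ (0, 0)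
      - A $$ (0, 1) * mat_delete A 0 1 $$ (0, 0)"
    using laplace_expansion_row[OF A, of 0] by (simp add: cofactor_def)
  then show ?thesis using A by (simp add: mat_delete_def)
qed

lemma det_3:
  assumes A: "A \<in> carrier_mat 3 3"
  shows "det A = det3 (A $$ (0, 0)) (A $$ (0, 1)) (A $$ (0, 2))
    (A $$ (1, 0)) (A $$ (1, 1)) (A $$ (1, 2)) (A $$ (2, 0)) (A $$ (2, 1)) (A $$ (2, 2))"
proof -
  have "{..<3::nat} = {0, 1, 2}" by auto
  then have "det A = A $$ (0, 0) * det (mat_delete A 0 0) - A $$ (0, 1) * det (mat_delete A 0 1)
      + A $$ (0, 2) * det (mat_delete A 0 2)"
    using laplace_expansion_row[OF A, of 0] by (simp add: cofactor_def)
  moreover have minor: "det (mat_delete A 0 j) = mat_delete A 0 j $$ (0, 0) * mat_delete A 0 j $$ (1, 1)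
      - mat_delete A 0 j $$ (0, 1) * mat_delete A 0 j $$ (1, 0)" for j
    using mat_delete_carrier[OF A, of 0 j] by (intro det_2) simp
  ultimately have "det A = A $$ (0, 0) * (mat_delete A 0 0 $$ (0, 0) * mat_delete A 0 0 $$ (1, 1)
        - mat_delete A 0 0 $$ (0, 1) * mat_delete A 0 0 $$ (1, 0))
      - A $$ (0, 1) * (mat_delete A 0 1 $$ (0, 0) * mat_delete A 0 1 $$ (1, 1)
        - mat_delete A 0 1 $$ (0, 1) * mat_delete A 0 1 $$ (1, 0))
      + A $$ (0, 2) * (mat_delete A 0 2 $$ (0, 0) * mat_delete A 0 2 $$ (1, 1)
        - mat_delete A 0 2 $$ (0, 1) * mat_delete A 0 2 $$ (1, 0))"
    by (simp only: minor)
  then show ?thesis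
    using A by (simp add: mat_delete_def det3_def flip: numeral_2_eq_2)
qed

lemma transposition_invariant_imp_perm_invariant:
  fixes F :: "nat \<Rightarrow> nat \<Rightarrow> nat \<Rightarrow> 'a"
  assumes sw: "\<And>p q r. F q p r = F p q r" "\<And>p q r. F p r q = F p q r"
    and perm: "p < 3" "q < 3" "r < 3" "p \<noteq> q" "q \<noteq> r" "p \<noteq> r"
  shows "F p q r = F 0 1 2"
proof -
  have "(p = 0 \<and> q = 1 \<and> r = 2) \<or> (p = 0 \<and> q = 2 \<and> r = 1) \<or> (p = 1 \<and> q = 0 \<and> r = 2)
      \<or> (p = 1 \<and> q = 2 \<and> r = 0) \<or> (p = 2 \<and> q = 0 \<and> r = 1) \<or> (p = 2 \<and> q = 1 \<and> r = 0)"
  proof -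
    have "x = 0 \<or> x = 1 \<or> x = 2" if "x < 3" for x :: nat using that by linarith
    from this[OF perm(1)] this[OF perm(2)] this[OF perm(3)] show ?thesis
      using perm(4-6) by (elim disjE) simp_all
  qed
  moreover have "F 0 2 1 = F 0 1 2" "F 1 0 2 = F 0 1 2" "F 1 2 0 = F 1 0 2"
      "F 2 0 1 = F 0 2 1" "F 2 1 0 = F 2 0 1"
    by (rule sw)+
  ultimately show ?thesis by (elim disjE) simp_all
qed

text \<open>This moves any two chosen entries to standard positions: \<open>p, q, r\<close> and \<open>s, t, u\<close> are
  arbitrary orderings of the row and column indices.\<close>

lemma abs_det_permuted:
  assumes A: "A \<in> carrier_mat 3 3"
    and rows: "p < 3" "q < 3" "r < 3" "p \<noteq> q" "q \<noteq> r" "p \<noteq> r"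
    and cols: "s < 3" "t < 3" "u < 3" "s \<noteq> t" "t \<noteq> u" "s \<noteq> u"
  shows "\<bar>det A\<bar> = \<bar>det3 (A $$ (p, s)) (A $$ (p, t)) (A $$ (p, u))
    (A $$ (q, s)) (A $$ (q, t)) (A $$ (q, u)) (A $$ (r, s)) (A $$ (r, t)) (A $$ (r, u))\<bar>"
proof -
  define D where "D p q r s t u = \<bar>det3 (A $$ (p, s)) (A $$ (p, t)) (A $$ (p, u))
    (A $$ (q, s)) (A $$ (q, t)) (A $$ (q, u)) (A $$ (r, s)) (A $$ (r, t)) (A $$ (r, u))\<bar>"
    for p q r s t u
  have swap: "\<bar>x\<bar> = \<bar>y\<bar>" if "x + y = 0" for x y :: int using that by linarith
  have "D p q r s t u = D 0 1 2 s t u"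
    by (rule transposition_invariant_imp_perm_invariant[of "\<lambda>p q r. D p q r s t u"])
       (use rows in \<open>auto simp: D_def det3_def algebra_simps intro!: swap\<close>)
  also have "\<dots> = D 0 1 2 0 1 2"
    by (rule transposition_invariant_imp_perm_invariant[of "D 0 1 2"])
       (use cols in \<open>auto simp: D_def det3_def algebra_simps intro!: swap\<close>)
  finally show ?thesis by (simp add: det_3[OF A] D_def)
qed

section \<open>Bounds when two entries are interior\<close>

text \<open>The determinant is affine in each single entry, so that entry may be replaced by whichever end
  point of its range is worse. The assumption encodes affinity by interpolation between 0 and 1.\<close>

lemma affine_le:
  fixes f :: "int \<Rightarrow> int"
  assumes affine: "\<And>s. f s = f 0 + s * (f 1 - f 0)"
    and t: "l \<le> t" "t \<le> u" and ends: "f l \<le> B" "f u \<le> B"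
  shows "f t \<le> B"
proof (cases "f 1 - f 0 \<ge> 0")
  case True
  then have "t * (f 1 - f 0) \<le> u * (f 1 - f 0)" using t by (intro mult_right_mono)
  then show ?thesis using ends affine[of t] affine[of u] by linarith
next
  case False
  then have "t * (f 1 - f 0) \<le> l * (f 1 - f 0)" using t by (intro mult_right_mono_neg) auto
  then show ?thesis using ends affine[of t] affine[of l] by linarith
qed

lemma affine_abs_le:
  fixes f :: "int \<Rightarrow> int"
  assumes affine: "\<And>s. f s = f 0 + s * (f 1 - f 0)"
    and t: "l \<le> t" "t \<le> u" and ends: "\<bar>f l\<bar> \<le> B" "\<bar>f u\<bar> \<le> B"
  shows "\<bar>f t\<bar> \<le> B"
proof -
  have "f t \<le> B" using affine_le[of f, OF affine t] ends by (auto simp: abs_le_iff)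
  moreover have "- f t \<le> B"
  proof (rule affine_le[of "\<lambda>s. - f s", OF _ t])
    show "- f s = - f 0 + s * (- f 1 - - f 0)" for s
      using affine[of s] by (simp add: algebra_simps)
  qed (use ends in \<open>auto simp: abs_le_iff\<close>)
  ultimately show ?thesis by linarith
qed

lemma mult_le_bound:
  fixes a b :: int
  assumes "0 \<le> a" "a \<le> m" "b \<le> n" "0 \<le> n"
  shows "a * b \<le> m * n"
proof -
  have "a * b \<le> a * n" using assms by (intro mult_left_mono)
  also have "\<dots> \<le> m * n" using assms by (intro mult_right_mono)
  finally show ?thesis .
qed

lemma abs_mult_le_bound:
  fixes a b :: int
  assumes "\<bar>a\<bar> \<le> m" "\<bar>b\<bar> \<le> n"
  shows "\<bar>a * b\<bar> \<le> m * n"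
  unfolding abs_mult using assms by (intro mult_mono) auto

lemma not_dvd_imp_interior:
  fixes x k :: int
  assumes "\<not> k dvd x"
  shows "0 \<le> x \<Longrightarrow> x \<le> k \<Longrightarrow> 1 \<le> x \<and> x \<le> k - 1"
    and "- k \<le> x \<Longrightarrow> x \<le> k \<Longrightarrow> \<bar>x\<bar> \<le> k - 1"
proof -
  have "x \<noteq> 0" "x \<noteq> k" "x \<noteq> - k" using assms by auto
  then show "0 \<le> x \<Longrightarrow> x \<le> k \<Longrightarrow> 1 \<le> x \<and> x \<le> k - 1" "- k \<le> x \<Longrightarrow> x \<le> k \<Longrightarrow> \<bar>x\<bar> \<le> k - 1"
    by linarith+
qed

text \<open>Chio condensation with pivot \<open>i\<close>.\<close>

lemma det3_pivot:
  "i * det3 x b c d y f g h i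
    = (x * i - c * g) * (y * i - f * h) - (b * i - c * h) * (d * i - f * g)"
  by (simp add: det3_def algebra_simps)

subsection \<open>Entries between 0 and k\<close>

text \<open>The estimates that are not sharp end at \<open>2k\<^sup>3 - 2k\<^sup>2\<close>, which is compared here with the claimed
  bound and with the trivial bound \<open>k\<^sup>3\<close> for one positive product.\<close>

lemma cubic_bounds:
  fixes k :: int
  assumes "k \<ge> 2"
  shows "2 * (k * (k * (k - 1))) \<le> k * (2 * k^2 - 2 * k + 1)"
    "k * (k * k) \<le> 2 * (k * (k * (k - 1)))"
proof -
  show "2 * (k * (k * (k - 1))) \<le> k * (2 * k^2 - 2 * k + 1)"
    using assms by (simp add: algebra_simps power2_eq_square)
  have "k * (k * 2) \<le> k * (k * k)" using assms by (intro mult_left_mono) auto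
  then show "k * (k * k) \<le> 2 * (k * (k * (k - 1)))" by (simp add: algebra_simps)
qed

text \<open>Pushing \<open>z\<close>, then \<open>f\<close>, then \<open>i\<close> to the end points kills or factors enough products that in each
  case at most two products bounded by \<open>k\<^sup>2 (k - 1)\<close>, or one bounded by \<open>k\<^sup>3\<close>, remain. It is essential
  that \<open>x\<close> and \<open>y\<close> also stay at least 1: a factor such as \<open>h - y\<close> is then at most \<open>k - 1\<close>.
  The one-sided bound suffices, as exchanging the other two rows changes the sign.\<close>

lemma det3_le_same_row:
  fixes k :: int
  assumes k: "k \<ge> 2" and x: "1 \<le> x" "x \<le> k - 1" and y: "1 \<le> y" "y \<le> k - 1"
    and z: "0 \<le> z" "z \<le> k"
    and d: "0 \<le> d" "d \<le> k" and e: "0 \<le> e" "e \<le> k" and f: "0 \<le> f" "f \<le> k"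
    and g: "0 \<le> g" "g \<le> k" and h: "0 \<le> h" "h \<le> k" and i: "0 \<le> i" "i \<le> k"
  shows "det3 x y z d e f g h i \<le> 2 * (k * (k * (k - 1)))"
proof (rule affine_le[where f = "\<lambda>z. det3 x y z d e f g h i", OF _ z])
  have "e * i \<le> k * k" "f * g \<le> k * k" using e i f g k by (auto intro!: mult_le_bound)
  then have "x * (e * i) \<le> (k - 1) * (k * k)" "y * (f * g) \<le> (k - 1) * (k * k)"
    using x y k by (auto intro!: mult_le_bound)
  moreover have "0 \<le> x * (f * h)" "0 \<le> y * (d * i)" using x y d f h i by simp_all
  ultimately show "det3 x y 0 d e f g h i \<le> 2 * (k * (k * (k - 1)))"
    by (simp add: det3_def algebra_simps)
next
  have hdx: "h * (d - x) \<le> k * (k - 1)" using h d x k by (intro mult_le_bound) auto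
  show "det3 x y k d e f g h i \<le> 2 * (k * (k * (k - 1)))"
  proof (rule affine_le[where f = "\<lambda>f. det3 x y k d e f g h i", OF _ f])
    show "det3 x y k d e 0 g h i \<le> 2 * (k * (k * (k - 1)))"
    proof (rule affine_le[where f = "\<lambda>i. det3 x y k d e 0 g h i", OF _ i])
      have "k * (d * h) \<le> k * (k * k)" using d h k by (intro mult_left_mono mult_le_bound) auto
      moreover have "0 \<le> k * (e * g)" using k e g by simp
      ultimately show "det3 x y k d e 0 g h 0 \<le> 2 * (k * (k * (k - 1)))"
        using cubic_bounds(2)[OF k] by (simp add: det3_def algebra_simps)
      have "e * x \<le> k * (k - 1)" "d * (h - y) \<le> k * (k - 1)" "0 \<le> e * g"
        using e x d h y g k by (auto intro!: mult_le_bound)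
      then have "k * (e * x + d * (h - y) - e * g) \<le> k * (2 * (k * (k - 1)))"
        using k by (intro mult_left_mono) auto
      then show "det3 x y k d e 0 g h k \<le> 2 * (k * (k * (k - 1)))"
        by (simp add: det3_def algebra_simps)
    qed (simp add: det3_def algebra_simps)
    show "det3 x y k d e k g h i \<le> 2 * (k * (k * (k - 1)))"
    proof (rule affine_le[where f = "\<lambda>i. det3 x y k d e k g h i", OF _ i])
      have gy: "g * y \<le> k * (k - 1)" using g y k by (intro mult_le_bound) auto
      moreover have "0 \<le> e * g" using e g by simp
      ultimately have "k * (g * y + h * (d - x) - e * g) \<le> k * (2 * (k * (k - 1)))"
        using k hdx by (intro mult_left_mono) auto
      then show "det3 x y k d e k g h 0 \<le> 2 * (k * (k * (k - 1)))"
        by (simp add: det3_def algebra_simps)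
      have "g * (y - e) + h * (d - x) + x * e - y * d \<le> 2 * (k * (k - 1))"
      proof (rule affine_le[where f = "\<lambda>e. g * (y - e) + h * (d - x) + x * e - y * d", OF _ e])
        have "0 \<le> y * d" using y d by simp
        then show "g * (y - 0) + h * (d - x) + x * 0 - y * d \<le> 2 * (k * (k - 1))"
          using gy hdx by simp
        have "g * (y - k) \<le> 0" using g y by (intro mult_nonneg_nonpos) auto
        moreover have "h * (d - x) + x * k - y * d \<le> 2 * (k * (k - 1))"
        proof (rule affine_le[where f = "\<lambda>h. h * (d - x) + x * k - y * d", OF _ h])
          have "k * x \<le> k * (k - 1)" using x k by (intro mult_left_mono) auto
          moreover have "0 \<le> k * (k - 1)" using k by simp
          ultimately show "0 * (d - x) + x * k - y * d \<le> 2 * (k * (k - 1))"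
            using \<open>0 \<le> y * d\<close> by (simp add: mult.commute)
          have "d * (k - y) \<le> k * (k - 1)" using d y k by (intro mult_le_bound) auto
          then show "k * (d - x) + x * k - y * d \<le> 2 * (k * (k - 1))"
            using \<open>0 \<le> k * (k - 1)\<close> by (simp add: algebra_simps)
        qed (simp add: algebra_simps)
        ultimately show "g * (y - k) + h * (d - x) + x * k - y * d \<le> 2 * (k * (k - 1))" by linarith
      qed (simp add: algebra_simps)
      then have "k * (g * (y - e) + h * (d - x) + x * e - y * d) \<le> k * (2 * (k * (k - 1)))"
        using k by (intro mult_left_mono) auto
      then show "det3 x y k d e k g h k \<le> 2 * (k * (k * (k - 1)))"
        by (simp add: det3_def algebra_simps)
    qed (simp add: det3_def algebra_simps)
  qed (simp add: det3_def algebra_simps)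
qed (simp add: det3_def algebra_simps)

lemma abs_det3_le_plus_same_row:
  fixes k :: int
  assumes k: "k \<ge> 2" and range: "{x, y, z, d, e, f, g, h, i} \<subseteq> {0..k}"
    and nd: "\<not> k dvd x" "\<not> k dvd y"
  shows "\<bar>det3 x y z d e f g h i\<bar> \<le> k * (2 * k^2 - 2 * k + 1)"
proof -
  have int: "1 \<le> x" "x \<le> k - 1" "1 \<le> y" "y \<le> k - 1"
    using range not_dvd_imp_interior(1)[OF nd(1)] not_dvd_imp_interior(1)[OF nd(2)] by simp_all
  have "det3 x y z g h i d e f = - det3 x y z d e f g h i"
    by (simp add: det3_def algebra_simps)
  moreover have "det3 x y z d e f g h i \<le> 2 * (k * (k * (k - 1)))"
      "det3 x y z g h i d e f \<le> 2 * (k * (k * (k - 1)))"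
    using range by (intro det3_le_same_row[OF k int]; simp)+
  ultimately show ?thesis using cubic_bounds(1)[OF k] by linarith
qed

text \<open>This is where the bound is sharp. For \<open>i = k\<close> the four factors in \<open>det3_pivot\<close> are differences
  of numbers in \<open>[0, k\<^sup>2]\<close>; those containing \<open>x\<close> or \<open>y\<close> are even at most \<open>k (k - 1)\<close> in absolute value,
  whence \<open>k \<bar>det A\<bar> \<le> k\<^sup>2 (k - 1)\<^sup>2 + k\<^sup>4\<close>. For \<open>i = 0\<close> cruder estimates suffice.\<close>

lemma abs_det3_le_plus_independent:
  fixes k :: int
  assumes k: "k \<ge> 2" and range: "{x, b, c, d, y, f, g, h, i} \<subseteq> {0..k}"
    and nd: "\<not> k dvd x" "\<not> k dvd y"
  shows "\<bar>det3 x b c d y f g h i\<bar> \<le> k * (2 * k^2 - 2 * k + 1)"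
proof -
  have x: "1 \<le> x" "x \<le> k - 1" and y: "1 \<le> y" "y \<le> k - 1"
    using range not_dvd_imp_interior(1)[OF nd(1)] not_dvd_imp_interior(1)[OF nd(2)] by simp_all
  have b: "0 \<le> b" "b \<le> k" and c: "0 \<le> c" "c \<le> k" and d: "0 \<le> d" "d \<le> k"
    and f: "0 \<le> f" "f \<le> k" and g: "0 \<le> g" "g \<le> k" and h: "0 \<le> h" "h \<le> k"
    and i: "0 \<le> i" "i \<le> k" using range by auto
  have diff: "\<bar>u - v\<bar> \<le> m" if "0 \<le> u" "u \<le> m" "0 \<le> v" "v \<le> m" for u v m :: int
    using that by linarith
  show ?thesis
  proof (rule affine_abs_le[where f = "\<lambda>i. det3 x b c d y f g h i", OF _ i])
    have bc: "f * (b * g - x * h) + c * (d * h - y * g) \<le> 2 * (k * (k * (k - 1)))"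
    proof -
      have le: "b * g - x * h \<le> k * g - h" "d * h - y * g \<le> k * h - g"
      proof -
        have "b * g \<le> k * g" "d * h \<le> k * h" using b d g h by (auto intro!: mult_right_mono)
        moreover have "h \<le> x * h" "g \<le> y * g"
          using x y g h mult_right_mono[of 1 x h] mult_right_mono[of 1 y g] by auto
        ultimately show "b * g - x * h \<le> k * g - h" "d * h - y * g \<le> k * h - g" by simp_all
      qed
      have "f * (b * g - x * h) + c * (d * h - y * g) \<le> f * (k * g - h) + c * (k * h - g)"
        using le f c by (intro add_mono mult_left_mono)
      also have "\<dots> \<le> 2 * (k * (k * (k - 1)))"
      proof (rule affine_le[where f = "\<lambda>f. f * (k * g - h) + c * (k * h - g)", OF _ f])
        have "k * h - g \<le> k * k" using h g k mult_left_mono[of h k k] by linarith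
        then have "c * (k * h - g) \<le> k * (k * k)" using c k by (intro mult_le_bound) auto
        then show "0 * (k * g - h) + c * (k * h - g) \<le> 2 * (k * (k * (k - 1)))"
          using cubic_bounds(2)[OF k] by simp
        show "k * (k * g - h) + c * (k * h - g) \<le> 2 * (k * (k * (k - 1)))"
        proof (rule affine_le[where f = "\<lambda>c. k * (k * g - h) + c * (k * h - g)", OF _ c])
          have "k * g - h \<le> k * k" using h g k mult_left_mono[of g k k] by linarith
          then have "k * (k * g - h) \<le> k * (k * k)" using k by (intro mult_left_mono) auto
          then show "k * (k * g - h) + 0 * (k * h - g) \<le> 2 * (k * (k * (k - 1)))"
            using cubic_bounds(2)[OF k] by simp
          have "(g + h) * (k * (k - 1)) \<le> (2 * k) * (k * (k - 1))"
            using g h k by (intro mult_right_mono) auto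
          then show "k * (k * g - h) + k * (k * h - g) \<le> 2 * (k * (k * (k - 1)))"
            by (simp add: algebra_simps)
        qed (simp add: algebra_simps)
      qed (simp add: algebra_simps)
      finally show ?thesis .
    qed
    have "f * h \<le> k * k" "c * g \<le> k * k" using f h c g k by (auto intro!: mult_le_bound)
    then have "x * (f * h) \<le> (k - 1) * (k * k)" "y * (c * g) \<le> (k - 1) * (k * k)"
      using x y k by (auto intro!: mult_le_bound)
    moreover have "0 \<le> f * (b * g)" "0 \<le> c * (d * h)" using b c d f g h by simp_all
    ultimately have "- (f * (b * g - x * h) + c * (d * h - y * g)) \<le> 2 * (k * (k * (k - 1)))"
      by (simp add: algebra_simps)
    moreover have "det3 x b c d y f g h 0 = f * (b * g - x * h) + c * (d * h - y * g)"
      by (simp add: det3_def algebra_simps)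
    ultimately show "\<bar>det3 x b c d y f g h 0\<bar> \<le> k * (2 * k^2 - 2 * k + 1)"
      using bc cubic_bounds(1)[OF k] by linarith
  next
    have inner: "\<bar>u * k - v\<bar> \<le> k * (k - 1)" if "1 \<le> u" "u \<le> k - 1" "0 \<le> v" "v \<le> k * k" for u v
    proof -
      have "1 * k \<le> u * k" "u * k \<le> (k - 1) * k" using that k by (intro mult_right_mono; simp)+
      then have "k \<le> u * k" "u * k \<le> k * k - k" by (simp_all only: left_diff_distrib mult_1)
      then show ?thesis using that unfolding right_diff_distrib mult_1_right by linarith
    qed
    have "0 \<le> c * g" "c * g \<le> k * k" "0 \<le> f * h" "f * h \<le> k * k"
        "0 \<le> c * h" "c * h \<le> k * k" "0 \<le> f * g" "f * g \<le> k * k"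
        "0 \<le> b * k" "b * k \<le> k * k" "0 \<le> d * k" "d * k \<le> k * k"
      using b c d f g h k by (auto intro!: mult_le_bound)
    then have "\<bar>x * k - c * g\<bar> \<le> k * (k - 1)" "\<bar>y * k - f * h\<bar> \<le> k * (k - 1)"
        "\<bar>b * k - c * h\<bar> \<le> k * k" "\<bar>d * k - f * g\<bar> \<le> k * k"
      using inner[OF x] inner[OF y] by (simp_all only: diff)
    then have "\<bar>(x * k - c * g) * (y * k - f * h)\<bar> \<le> (k * (k - 1)) * (k * (k - 1))"
        "\<bar>(b * k - c * h) * (d * k - f * g)\<bar> \<le> (k * k) * (k * k)"
      by (simp_all only: abs_mult_le_bound)
    then have "\<bar>k * det3 x b c d y f g h k\<bar> \<le> (k * (k - 1)) * (k * (k - 1)) + (k * k) * (k * k)"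
      unfolding det3_pivot by linarith
    also have "\<dots> = k * (k * (2 * k^2 - 2 * k + 1))"
      by (simp add: algebra_simps power2_eq_square)
    finally show "\<bar>det3 x b c d y f g h k\<bar> \<le> k * (2 * k^2 - 2 * k + 1)"
      using k by (simp add: abs_mult)
  qed (simp add: det3_def algebra_simps)
qed

subsection \<open>Entries between -k and k\<close>

text \<open>With suitable signs \<open>s, t, u\<close> the sum is a determinant with first row \<open>(s, t, u)\<close>. Expanded along
  the next row, its coefficients are, up to sign, the pairwise differences of three numbers in
  \<open>[-k, k]\<close>, and the distances between three numbers add up to twice the largest distance, hence to
  at most \<open>4k\<close>.\<close>

lemma sum_abs_minors_le:
  fixes k :: int
  assumes "{d, e, f, g, h, i} \<subseteq> {-k..k}"
  shows "\<bar>e * i - f * h\<bar> + \<bar>d * i - f * g\<bar> + \<bar>d * h - e * g\<bar> \<le> 4 * (k * k)"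
proof -
  have D: "\<bar>det3 s t u d e f g h i\<bar> \<le> 4 * (k * k)" if "{s, t, u} \<subseteq> {-1, 1}" for s t u
  proof -
    have "\<bar>u * h - t * i\<bar> + \<bar>s * i - u * g\<bar> + \<bar>t * g - s * h\<bar> \<le> 4 * k"
    proof -
      have "\<bar>g\<bar> \<le> k" "\<bar>h\<bar> \<le> k" "\<bar>i\<bar> \<le> k" using assms by auto
      moreover have "s = -1 \<or> s = 1" "t = -1 \<or> t = 1" "u = -1 \<or> u = 1" using that by auto
      ultimately show ?thesis by (elim disjE; simp; linarith)
    qed
    then have "k * (\<bar>u * h - t * i\<bar> + \<bar>s * i - u * g\<bar> + \<bar>t * g - s * h\<bar>) \<le> k * (4 * k)"
      using assms by (intro mult_left_mono) auto
    also have "k * (4 * k) = 4 * (k * k)" by simp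
    finally have "k * \<bar>u * h - t * i\<bar> + k * \<bar>s * i - u * g\<bar> + k * \<bar>t * g - s * h\<bar> \<le> 4 * (k * k)"
      by (simp only: distrib_left)
    moreover have "\<bar>d * (u * h - t * i)\<bar> \<le> k * \<bar>u * h - t * i\<bar>"
        "\<bar>e * (s * i - u * g)\<bar> \<le> k * \<bar>s * i - u * g\<bar>"
        "\<bar>f * (t * g - s * h)\<bar> \<le> k * \<bar>t * g - s * h\<bar>"
      using assms by (intro abs_mult_le_bound order_refl; auto simp: abs_le_iff)+
    moreover have "det3 s t u d e f g h i
        = d * (u * h - t * i) + e * (s * i - u * g) + f * (t * g - s * h)"
      by (simp add: det3_def algebra_simps)
    ultimately show ?thesis by linarith
  qed
  define sg :: "int \<Rightarrow> int" where "sg v = (if v < 0 then -1 else 1)" for v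
  have "sg v * v = \<bar>v\<bar>" "sg v \<in> {-1, 1}" "- sg v \<in> {-1, 1}" for v by (auto simp: sg_def)
  then show ?thesis
    using D[of "sg (e * i - f * h)" "- sg (d * i - f * g)" "sg (d * h - e * g)"]
    by (simp add: det3_def)
qed

text \<open>If \<open>p, q, r\<close> are the minors that belong to \<open>x, y, z\<close>, then
  \<open>\<bar>det A\<bar> \<le> (k - 1) (\<bar>p\<bar> + \<bar>q\<bar> + \<bar>r\<bar>) + \<bar>r\<bar> \<le> 4 k\<^sup>2 (k - 1) + 2 k\<^sup>2\<close>.\<close>

lemma abs_det3_le_minus_same_row:
  fixes k :: int
  assumes k: "k \<ge> 2" and range: "{x, y, z, d, e, f, g, h, i} \<subseteq> {-k..k}"
    and nd: "\<not> k dvd x" "\<not> k dvd y"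
  shows "\<bar>det3 x y z d e f g h i\<bar> \<le> k * (2 * k - 1) * (2 * k + 1)"
proof -
  define p q r where "p = e * i - f * h" and "q = d * i - f * g" and "r = d * h - e * g"
  have x: "\<bar>x\<bar> \<le> k - 1" and y: "\<bar>y\<bar> \<le> k - 1" and z: "\<bar>z\<bar> \<le> k"
    using range not_dvd_imp_interior(2)[OF nd(1)] not_dvd_imp_interior(2)[OF nd(2)] by auto
  have "\<bar>x * p\<bar> \<le> (k - 1) * \<bar>p\<bar>" "\<bar>y * q\<bar> \<le> (k - 1) * \<bar>q\<bar>" "\<bar>z * r\<bar> \<le> k * \<bar>r\<bar>"
    using x y z by (auto intro!: abs_mult_le_bound)
  moreover have "det3 x y z d e f g h i = x * p - y * q + z * r"
    by (simp add: det3_def p_def q_def r_def)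
  then have "\<bar>det3 x y z d e f g h i\<bar> \<le> \<bar>x * p\<bar> + \<bar>y * q\<bar> + \<bar>z * r\<bar>" by linarith
  ultimately have "\<bar>det3 x y z d e f g h i\<bar> \<le> (k - 1) * (\<bar>p\<bar> + \<bar>q\<bar> + \<bar>r\<bar>) + \<bar>r\<bar>"
    by (simp add: algebra_simps)
  moreover have "(k - 1) * (\<bar>p\<bar> + \<bar>q\<bar> + \<bar>r\<bar>) \<le> (k - 1) * (4 * (k * k))"
    using sum_abs_minors_le[of d e f g h i k] range k
    by (intro mult_left_mono) (auto simp: p_def q_def r_def)
  moreover have "\<bar>r\<bar> \<le> 2 * (k * k)"
  proof -
    have "\<bar>d * h\<bar> \<le> k * k" "\<bar>e * g\<bar> \<le> k * k"
      using range by (intro abs_mult_le_bound; auto simp: abs_le_iff)+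
    then show ?thesis unfolding r_def by linarith
  qed
  moreover have "(k - 1) * (4 * (k * k)) + 2 * (k * k) \<le> k * (2 * k - 1) * (2 * k + 1)"
    using k mult_left_mono[of 1 k k] by (simp add: algebra_simps)
  ultimately show ?thesis by linarith
qed

text \<open>When the five entries of the last row and column are \<open>\<plusminus>k\<close>, scaling rows and columns by \<open>\<plusminus>1\<close>
  makes them all equal to \<open>k\<close>. The pivot identity then turns the determinant into
  \<open>\<plusminus>k ((k - X) (k - Y) - (k - B) (k - D))\<close> with \<open>\<bar>X\<bar>, \<bar>Y\<bar> \<le> k - 1\<close> and \<open>\<bar>B\<bar>, \<bar>D\<bar> \<le> k\<close>. The first product lies
  between \<open>1\<close> and \<open>(2k - 1)\<^sup>2\<close>, the second between \<open>0\<close> and \<open>4k\<^sup>2\<close>, so their difference is at most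
  \<open>4k\<^sup>2 - 1\<close> in absolute value.\<close>

lemma abs_det3_le_minus_corner:
  fixes k :: int
  assumes k: "k \<ge> 2" and x: "\<bar>x\<bar> \<le> k - 1" and y: "\<bar>y\<bar> \<le> k - 1"
    and b: "\<bar>b\<bar> \<le> k" and d: "\<bar>d\<bar> \<le> k"
    and corner: "{c, f, g, h, i} \<subseteq> {-k, k}"
  shows "\<bar>det3 x b c d y f g h i\<bar> \<le> k * (2 * k - 1) * (2 * k + 1)"
proof -
  define U where "U u v = (k - u) * (k - v)" for u v
  have U1: "1 \<le> U u v" "U u v \<le> (2 * k - 1) * (2 * k - 1)"
    if "\<bar>u\<bar> \<le> k - 1" "\<bar>v\<bar> \<le> k - 1" for u v
    using that k mult_mono[of 1 "k - u" 1 "k - v"]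
      mult_mono[of "k - u" "2 * k - 1" "k - v" "2 * k - 1"] by (auto simp: U_def)
  have U0: "0 \<le> U u v" "U u v \<le> (2 * k) * (2 * k)" if "\<bar>u\<bar> \<le> k" "\<bar>v\<bar> \<le> k" for u v
    using that k mult_mono[of "k - u" "2 * k" "k - v" "2 * k"] by (auto simp: U_def)
  have sgn: "\<exists>s. (s = -1 \<or> s = 1) \<and> t = s * k" if "t \<in> {-k, k}" for t using that by auto
  obtain \<gamma> where \<gamma>: "\<gamma> = -1 \<or> \<gamma> = 1" "c = \<gamma> * k" using corner sgn[of c] by auto
  obtain \<phi> where \<phi>: "\<phi> = -1 \<or> \<phi> = 1" "f = \<phi> * k" using corner sgn[of f] by auto
  obtain \<eta> where \<eta>: "\<eta> = -1 \<or> \<eta> = 1" "g = \<eta> * k" using corner sgn[of g] by auto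
  obtain \<theta> where \<theta>: "\<theta> = -1 \<or> \<theta> = 1" "h = \<theta> * k" using corner sgn[of h] by auto
  obtain \<iota> where \<iota>: "\<iota> = -1 \<or> \<iota> = 1" "i = \<iota> * k" using corner sgn[of i] by auto
  note signs = \<gamma>(1) \<phi>(1) \<eta>(1) \<theta>(1) \<iota>(1) and eqs = \<gamma>(2) \<phi>(2) \<eta>(2) \<theta>(2) \<iota>(2)
  define X Y B D where "X = \<iota> * \<gamma> * \<eta> * x" and "Y = \<iota> * \<phi> * \<theta> * y"
    and "B = \<iota> * \<gamma> * \<theta> * b" and "D = \<iota> * \<phi> * \<eta> * d"
  have one: "\<bar>\<gamma>\<bar> = 1" "\<bar>\<phi>\<bar> = 1" "\<bar>\<eta>\<bar> = 1" "\<bar>\<theta>\<bar> = 1" "\<bar>\<iota>\<bar> = 1" using signs by auto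
  have XY: "\<bar>X\<bar> \<le> k - 1" "\<bar>Y\<bar> \<le> k - 1" "\<bar>B\<bar> \<le> k" "\<bar>D\<bar> \<le> k"
    using x y b d one by (simp_all add: X_def Y_def B_def D_def abs_mult)
  have "det3 x b c d y f g h i = \<iota> * \<gamma> * \<phi> * \<eta> * \<theta> * k * (U X Y - U B D)"
    using signs unfolding eqs X_def Y_def B_def D_def U_def det3_def
    by (elim disjE) (simp_all add: algebra_simps)
  then have "\<bar>det3 x b c d y f g h i\<bar> = k * \<bar>U X Y - U B D\<bar>"
    using one k by (simp add: abs_mult)
  also have "\<dots> \<le> k * ((2 * k - 1) * (2 * k + 1))"
    using U1[OF XY(1,2)] U0[OF XY(3,4)] k
    by (intro mult_left_mono) (auto simp: algebra_simps abs_le_iff)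
  finally show ?thesis by (simp add: mult.assoc)
qed

lemma abs_det3_le_minus_independent:
  fixes k :: int
  assumes k: "k \<ge> 2" and range: "{x, b, c, d, y, f, g, h, i} \<subseteq> {-k..k}"
    and nd: "\<not> k dvd x" "\<not> k dvd y"
  shows "\<bar>det3 x b c d y f g h i\<bar> \<le> k * (2 * k - 1) * (2 * k + 1)"
proof -
  have x: "\<bar>x\<bar> \<le> k - 1" and y: "\<bar>y\<bar> \<le> k - 1" and b: "\<bar>b\<bar> \<le> k" and d: "\<bar>d\<bar> \<le> k"
    using range not_dvd_imp_interior(2)[OF nd(1)] not_dvd_imp_interior(2)[OF nd(2)] by auto
  note corner = abs_det3_le_minus_corner[OF k x y b d]
  \<comment> \<open>The entries of the last row and column are released from the end points one at a time.\<close>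
  let ?B = "k * (2 * k - 1) * (2 * k + 1)"
  have c: "\<bar>det3 x b c d y f g h i\<bar> \<le> ?B" if "{f, g, h, i} \<subseteq> {-k, k}" for f g h i
  proof (rule affine_abs_le[where f = "\<lambda>c. det3 x b c d y f g h i" and l = "-k" and u = k])
    show "\<bar>det3 x b (-k) d y f g h i\<bar> \<le> ?B" "\<bar>det3 x b k d y f g h i\<bar> \<le> ?B"
      using that by (intro corner; simp)+
  qed (use range in \<open>auto simp: det3_def algebra_simps\<close>)
  have f: "\<bar>det3 x b c d y f g h i\<bar> \<le> ?B" if "{g, h, i} \<subseteq> {-k, k}" for g h i
  proof (rule affine_abs_le[where f = "\<lambda>f. det3 x b c d y f g h i" and l = "-k" and u = k])
    show "\<bar>det3 x b c d y (-k) g h i\<bar> \<le> ?B" "\<bar>det3 x b c d y k g h i\<bar> \<le> ?B"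
      using that by (intro c; simp)+
  qed (use range in \<open>auto simp: det3_def algebra_simps\<close>)
  have g: "\<bar>det3 x b c d y f g h i\<bar> \<le> ?B" if "{h, i} \<subseteq> {-k, k}" for h i
  proof (rule affine_abs_le[where f = "\<lambda>g. det3 x b c d y f g h i" and l = "-k" and u = k])
    show "\<bar>det3 x b c d y f (-k) h i\<bar> \<le> ?B" "\<bar>det3 x b c d y f k h i\<bar> \<le> ?B"
      using that by (intro f; simp)+
  qed (use range in \<open>auto simp: det3_def algebra_simps\<close>)
  have h: "\<bar>det3 x b c d y f g h i\<bar> \<le> ?B" if "{i} \<subseteq> {-k, k}" for i
  proof (rule affine_abs_le[where f = "\<lambda>h. det3 x b c d y f g h i" and l = "-k" and u = k])
    show "\<bar>det3 x b c d y f g (-k) i\<bar> \<le> ?B" "\<bar>det3 x b c d y f g k i\<bar> \<le> ?B"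
      using that by (intro g; simp)+
  qed (use range in \<open>auto simp: det3_def algebra_simps\<close>)
  show ?thesis
  proof (rule affine_abs_le[where f = "\<lambda>i. det3 x b c d y f g h i" and l = "-k" and u = k])
    show "\<bar>det3 x b c d y f g h (-k)\<bar> \<le> ?B" "\<bar>det3 x b c d y f g h k\<bar> \<le> ?B"
      by (intro h; simp)+
  qed (use range in \<open>auto simp: det3_def algebra_simps\<close>)
qed

section \<open>Minors of unimodular matrices\<close>

lemma third_index:
  fixes p q :: nat
  assumes "p < 3" "q < 3"
  obtains r where "r < 3" "r \<noteq> p" "r \<noteq> q"
proof -
  have "\<exists>r\<in>{0, 1, 2 :: nat}. r \<noteq> p \<and> r \<noteq> q" by auto
  then obtain r where "r \<in> {0, 1, 2}" "r \<noteq> p" "r \<noteq> q" by blast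
  then show ?thesis using that[of r] by auto
qed

text \<open>Otherwise the entries not divisible by \<open>k\<close> occupy at most one position, and the two rows avoiding
  it make \<open>k\<close> divide the determinant of \<open>M\<close>.\<close>

lemma exists_two_nondivisible_entries:
  fixes M :: "int mat"
  assumes M: "M \<in> carrier_mat 4 4" and uni: "unimodular M" and k: "k \<ge> 2"
    and ij: "i < 4" "j < 4"
  obtains p s q t where "p < 3" "s < 3" "q < 3" "t < 3" "(p, s) \<noteq> (q, t)"
    "\<not> k dvd mat_delete M i j $$ (p, s)" "\<not> k dvd mat_delete M i j $$ (q, t)"
proof (rule ccontr)
  let ?A = "mat_delete M i j"
  note witness = that
  assume "\<not> thesis"
  then have unique: "(p, s) = (q, t)" if "p < 3" "s < 3" "q < 3" "t < 3"
      "\<not> k dvd ?A $$ (p, s)" "\<not> k dvd ?A $$ (q, t)" for p s q t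
    using that witness \<open>\<not> thesis\<close> by blast
  have "\<exists>p<3. \<forall>q<3. q \<noteq> p \<longrightarrow> (\<forall>s<3. k dvd ?A $$ (q, s))"
  proof (cases "\<exists>p<3. \<exists>s<3. \<not> k dvd ?A $$ (p, s)")
    case True
    then show ?thesis using unique by blast
  qed (auto intro: exI[of _ 0])
  then obtain p where p: "p < 3" "\<And>q s. q < 3 \<Longrightarrow> q \<noteq> p \<Longrightarrow> s < 3 \<Longrightarrow> k dvd ?A $$ (q, s)"
    by blast
  obtain q where q: "q < 3" "q \<noteq> p" using third_index[OF p(1) p(1)] by metis
  obtain r where r: "r < 3" "r \<noteq> p" "r \<noteq> q" using third_index[OF p(1) q(1)] by metis
  have row: "k dvd M $$ (insert_index i q, c)" if "q < 3" "q \<noteq> p" "c < 4" "c \<noteq> j" for q c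
  proof -
    have "insert_index j (delete_index j c) = c" "delete_index j c < 3"
      using that ij by (auto simp: insert_delete_index delete_index_def)
    then have "M $$ (insert_index i q, c) = ?A $$ (q, delete_index j c)"
      using mat_delete_index[of M 3 i j q "delete_index j c"] M ij that by simp
    then show ?thesis using p(2)[OF that(1,2)] \<open>delete_index j c < 3\<close> by simp
  qed
  have "k dvd det M"
  proof (rule dvd_det_of_dvd_two_rows[OF M ij(2)])
    show "insert_index i q < 4" "insert_index i r < 4" "insert_index i q \<noteq> insert_index i r"
      using q r by (auto simp: insert_index_def)
  qed (use row q r in auto)
  then show False using uni k by (auto simp: unimodular_def dest: zdvd_imp_le)
qed

text \<open>Common reduction for both entry ranges. Two indivisible entries in one column are moved to one
  row by transposition.\<close>

lemma abs_minor_le: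
  fixes k :: int
  assumes k: "k \<ge> 2" and M: "M \<in> carrier_mat 4 4" and uni: "unimodular M"
    and range: "elements_mat M \<subseteq> {l..k}" and ij: "i < 4" "j < 4"
    and same_row: "\<And>a b c d e f g h i. {a, b, c, d, e, f, g, h, i} \<subseteq> {l..k}
      \<Longrightarrow> \<not> k dvd a \<Longrightarrow> \<not> k dvd b \<Longrightarrow> \<bar>det3 a b c d e f g h i\<bar> \<le> B"
    and independent: "\<And>a b c d e f g h i. {a, b, c, d, e, f, g, h, i} \<subseteq> {l..k}
      \<Longrightarrow> \<not> k dvd a \<Longrightarrow> \<not> k dvd e \<Longrightarrow> \<bar>det3 a b c d e f g h i\<bar> \<le> B"
  shows "\<bar>det (mat_delete M i j)\<bar> \<le> B"
proof -
  define A where "A = mat_delete M i j"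
  have A: "A \<in> carrier_mat 3 3" using mat_delete_carrier[OF M, of i j] by (simp add: A_def)
  have entry: "A $$ (p, s) \<in> {l..k}" if "p < 3" "s < 3" for p s
  proof -
    have "A $$ (p, s) = M $$ (insert_index i p, insert_index j s)"
      using mat_delete_index[of M 3 i j p s] M ij that by (simp add: A_def)
    moreover have "insert_index i p < 4" "insert_index j s < 4"
      using that by (auto simp: insert_index_def)
    ultimately show ?thesis using range elements_matI[OF M] by blast
  qed
  have row: "\<bar>det C\<bar> \<le> B"
    if C: "C \<in> carrier_mat 3 3" "\<And>p s. p < 3 \<Longrightarrow> s < 3 \<Longrightarrow> C $$ (p, s) \<in> {l..k}"
      and pst: "p < 3" "s < 3" "t < 3" "s \<noteq> t"
      and nd: "\<not> k dvd C $$ (p, s)" "\<not> k dvd C $$ (p, t)" for C p s t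
  proof -
    obtain u where u: "u < 3" "u \<noteq> s" "u \<noteq> t" using third_index[OF pst(2,3)] .
    obtain q where q: "q < 3" "q \<noteq> p" using third_index[OF pst(1) pst(1)] by metis
    obtain r where r: "r < 3" "r \<noteq> p" "r \<noteq> q" using third_index[OF pst(1) q(1)] .
    show ?thesis
      unfolding abs_det_permuted[OF C(1) pst(1) q(1) r(1) q(2)[symmetric] r(3)[symmetric]
          r(2)[symmetric] pst(2,3) u(1) pst(4) u(3)[symmetric] u(2)[symmetric]]
      by (rule same_row[OF _ nd]) (use C(2) pst q r u in blast)
  qed
  obtain p s q t where pq: "p < 3" "s < 3" "q < 3" "t < 3" "(p, s) \<noteq> (q, t)"
      and nd: "\<not> k dvd A $$ (p, s)" "\<not> k dvd A $$ (q, t)"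
    using exists_two_nondivisible_entries[OF M uni k ij] unfolding A_def .
  consider "p = q" "s \<noteq> t" | "s = t" "p \<noteq> q" | "p \<noteq> q" "s \<noteq> t" using pq(5) by auto
  then have "\<bar>det A\<bar> \<le> B"
  proof cases
    case 1
    then show ?thesis using row[of A p s t] A entry pq nd by simp
  next
    case 2
    have "\<bar>det A\<^sup>T\<bar> \<le> B"
      using row[of "A\<^sup>T" s p q] A entry pq nd 2 by simp
    then show ?thesis by (simp add: det_transpose[OF A])
  next
    case 3
    obtain r where r: "r < 3" "r \<noteq> p" "r \<noteq> q" using third_index[OF pq(1,3)] .
    obtain u where u: "u < 3" "u \<noteq> s" "u \<noteq> t" using third_index[OF pq(2,4)] .
    show ?thesis
      unfolding abs_det_permuted[OF A pq(1,3) r(1) 3(1) r(3)[symmetric] r(2)[symmetric]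
          pq(2,4) u(1) 3(2) u(3)[symmetric] u(2)[symmetric]]
      by (rule independent[OF _ nd]) (use entry pq r u in blast)
  qed
  then show ?thesis by (simp add: A_def)
qed

lemma abs_minor_le_plus:
  fixes k :: int
  assumes "k \<ge> 2" "M \<in> carrier_mat 4 4" "unimodular M" "elements_mat M \<subseteq> {0..k}" "i < 4" "j < 4"
  shows "\<bar>det (mat_delete M i j)\<bar> \<le> k * (2 * k^2 - 2 * k + 1)"
  by (rule abs_minor_le[OF assms])
     (fact abs_det3_le_plus_same_row[OF assms(1)] abs_det3_le_plus_independent[OF assms(1)])+

lemma abs_minor_le_minus:
  fixes k :: int
  assumes "k \<ge> 2" "M \<in> carrier_mat 4 4" "unimodular M" "elements_mat M \<subseteq> {-k..k}" "i < 4" "j < 4"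
  shows "\<bar>det (mat_delete M i j)\<bar> \<le> k * (2 * k - 1) * (2 * k + 1)"
  by (rule abs_minor_le[OF assms])
     (fact abs_det3_le_minus_same_row[OF assms(1)] abs_det3_le_minus_independent[OF assms(1)])+

section \<open>Extremal matrices\<close>

definition mat4 :: "int list list \<Rightarrow> int mat" where
  "mat4 rs = mat 4 4 (\<lambda>(i, j). rs ! i ! j)"

text \<open>
  The leading \<open>3 \<times> 3\<close> blocks realise equality in the sharp estimates: in the nonnegative case two
  entries \<open>k\<close> of a corner with determinant \<open>2k\<^sup>3\<close> are lowered by 1 inside the same product, so that
  \<open>k (k - 1)\<^sup>2 + k\<^sup>3\<close> results; in the signed case two entries \<open>-k\<close> with vanishing cofactor are raised by
  1, which costs only the second-order term \<open>k\<close>. The last row and column, with corner entry 0,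
  are small vectors chosen to complete these blocks to determinant \<open>\<plusminus>1\<close>.
\<close>

definition extremal_plus :: "int \<Rightarrow> int mat" where
  "extremal_plus k = mat4 [[k - 1, k, 0, 1], [0, k - 1, k, 0], [k, 0, k, 1], [0, 1, 1, 0]]"

definition extremal_minus :: "int \<Rightarrow> int mat" where
  "extremal_minus k = mat4 [[-k, k, k, 1], [k, 1 - k, k, 0], [k, k, 1 - k, -1], [1, -1, 1, 0]]"

lemma elements_mat4:
  "elements_mat (mat4 rs) = (\<lambda>(i, j). rs ! i ! j) ` ({0, 1, 2, 3} \<times> {0, 1, 2, 3})"
proof -
  have "elements_mat (mat4 rs) = (\<lambda>(i, j). rs ! i ! j) ` ({..<4} \<times> {..<4})"
    by (force simp: elements_mat_def mat4_def)
  also have "{..<4::nat} = {0, 1, 2, 3}" by auto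
  finally show ?thesis .
qed

lemma det_mat4_delete:
  assumes "j < 4"
  shows "det (mat_delete (mat4 rs) 3 j) = (let c = \<lambda>i s. rs ! i ! insert_index j s in
    det3 (c 0 0) (c 0 1) (c 0 2) (c 1 0) (c 1 1) (c 1 2) (c 2 0) (c 2 1) (c 2 2))"
proof -
  have M: "mat4 rs \<in> carrier_mat 4 4" by (simp add: mat4_def)
  have D: "mat_delete (mat4 rs) 3 j \<in> carrier_mat 3 3"
    using mat_delete_carrier[OF M, of 3 j] by simp
  have "mat_delete (mat4 rs) 3 j $$ (i, s) = rs ! i ! insert_index j s"
    if "i < 3" "s < 3" for i s
    using that assms by (simp add: mat_delete_def mat4_def insert_index_def)
  then show ?thesis by (simp add: det_3[OF D] Let_def)
qed

lemma det_mat4: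
  "det (mat4 rs) = (\<Sum>j<4. rs ! 3 ! j * (-1) ^ (3 + j) * det (mat_delete (mat4 rs) 3 j))"
proof -
  have M: "mat4 rs \<in> carrier_mat 4 4" by (simp add: mat4_def)
  show ?thesis
    unfolding laplace_expansion_row[OF M, of 3, simplified]
    by (rule sum.cong) (simp_all add: cofactor_def mat4_def)
qed

lemma extremal_plus:
  assumes k: "k \<ge> 2"
  shows "extremal_plus k \<in> carrier_mat 4 4" "unimodular (extremal_plus k)"
    "elements_mat (extremal_plus k) \<subseteq> {0..k}" "max_norm (extremal_plus k) = k"
    "\<bar>det (mat_delete (extremal_plus k) 3 3)\<bar> = k * (2 * k^2 - 2 * k + 1)"
proof -
  show C: "extremal_plus k \<in> carrier_mat 4 4" by (simp add: extremal_plus_def mat4_def)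
  have four: "{..<4::nat} = {0, 1, 2, 3}" by auto
  have "det (extremal_plus k) = 1 \<or> det (extremal_plus k) = -1"
    by (simp add: extremal_plus_def det_mat4 four det_mat4_delete det3_def Let_def
        insert_index_def algebra_simps)
  then show "unimodular (extremal_plus k)" using C by (simp add: unimodular_def)
  show range: "elements_mat (extremal_plus k) \<subseteq> {0..k}"
    using k unfolding extremal_plus_def elements_mat4 by (auto simp: numeral_2_eq_2 numeral_3_eq_3)
  have "k \<in> elements_mat (extremal_plus k)"
    by (rule elements_matI[OF C, of 0 1]) (simp_all add: extremal_plus_def mat4_def)
  then show "max_norm (extremal_plus k) = k" unfolding max_norm_def
    using range k by (intro Max_eqI) (force simp: elements_mat_def)+
  have "det (mat_delete (extremal_plus k) 3 3) = k * (2 * k^2 - 2 * k + 1)"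
    by (simp add: extremal_plus_def det_mat4_delete det3_def Let_def insert_index_def
        algebra_simps power2_eq_square)
  moreover have "0 \<le> k * (2 * k^2 - 2 * k + 1)"
  proof -
    have "0 \<le> k * (k - 1)" using k by simp
    then have "0 \<le> 2 * k^2 - 2 * k + 1" by (simp add: algebra_simps power2_eq_square)
    then show ?thesis using k by simp
  qed
  ultimately show "\<bar>det (mat_delete (extremal_plus k) 3 3)\<bar> = k * (2 * k^2 - 2 * k + 1)" by simp
qed

lemma extremal_minus:
  assumes k: "k \<ge> 2"
  shows "extremal_minus k \<in> carrier_mat 4 4" "unimodular (extremal_minus k)"
    "elements_mat (extremal_minus k) \<subseteq> {-k..k}" "max_norm (extremal_minus k) = k"
    "\<bar>det (mat_delete (extremal_minus k) 3 3)\<bar> = k * (2 * k - 1) * (2 * k + 1)"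
proof -
  show C: "extremal_minus k \<in> carrier_mat 4 4" by (simp add: extremal_minus_def mat4_def)
  have four: "{..<4::nat} = {0, 1, 2, 3}" by auto
  have "det (extremal_minus k) = 1 \<or> det (extremal_minus k) = -1"
    by (simp add: extremal_minus_def det_mat4 four det_mat4_delete det3_def Let_def
        insert_index_def algebra_simps)
  then show "unimodular (extremal_minus k)" using C by (simp add: unimodular_def)
  show range: "elements_mat (extremal_minus k) \<subseteq> {-k..k}"
    using k unfolding extremal_minus_def elements_mat4 by (auto simp: numeral_2_eq_2 numeral_3_eq_3)
  have "k \<in> elements_mat (extremal_minus k)"
    by (rule elements_matI[OF C, of 0 1]) (simp_all add: extremal_minus_def mat4_def)
  then show "max_norm (extremal_minus k) = k" unfolding max_norm_def
    using range k by (intro Max_eqI) (force simp: elements_mat_def)+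
  have "det (mat_delete (extremal_minus k) 3 3) = k * (2 * k - 1) * (2 * k + 1)"
    by (simp add: extremal_minus_def det_mat4_delete det3_def Let_def insert_index_def
        algebra_simps power2_eq_square)
  moreover have "0 \<le> k * (2 * k - 1) * (2 * k + 1)" using k by simp
  ultimately show "\<bar>det (mat_delete (extremal_minus k) 3 3)\<bar> = k * (2 * k - 1) * (2 * k + 1)"
    by simp
qed

section \<open>The two maxima\<close>

lemma elements_mat_abs_le_max_norm:
  assumes "a \<in> elements_mat M"
  shows "\<bar>a\<bar> \<le> max_norm M"
  unfolding max_norm_def using assms by (intro Max_ge) (auto simp: elements_mat_def)

lemma beta_plus_eq:
  assumes k: "k \<ge> 2"
  shows "beta_plus k = k * (2 * k^2 - 2 * k + 1)"
  unfolding beta_plus_def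
proof (rule Max_max_norm_inverse[where n = 4 and W = "extremal_plus k" and i = 3 and j = 3])
  fix M i j
  assume M: "M \<in> carrier_mat 4 4 \<and> unimodular M \<and> elements_mat M \<subseteq> {0..} \<and> max_norm M = k"
    and ij: "i < (4::nat)" "j < (4::nat)"
  have "elements_mat M \<subseteq> {0..k}"
    using M elements_mat_abs_le_max_norm[of _ M] by fastforce
  then show "\<bar>det (mat_delete M i j)\<bar> \<le> k * (2 * k^2 - 2 * k + 1)"
    using abs_minor_le_plus[OF k] M ij by blast
next
  show "extremal_plus k \<in> carrier_mat 4 4 \<and> unimodular (extremal_plus k)
      \<and> elements_mat (extremal_plus k) \<subseteq> {0..} \<and> max_norm (extremal_plus k) = k"
    using extremal_plus(1-4)[OF k] by fastforce
qed (use extremal_plus(5)[OF k] in auto)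

lemma beta_minus_eq:
  assumes k: "k \<ge> 2"
  shows "beta_minus k = k * (2 * k - 1) * (2 * k + 1)"
  unfolding beta_minus_def
proof (rule Max_max_norm_inverse[where n = 4 and W = "extremal_minus k" and i = 3 and j = 3])
  fix M i j
  assume M: "M \<in> carrier_mat 4 4 \<and> unimodular M \<and> max_norm M = k"
    and ij: "i < (4::nat)" "j < (4::nat)"
  have "elements_mat M \<subseteq> {-k..k}"
    using M elements_mat_abs_le_max_norm[of _ M] by (fastforce simp: abs_le_iff)
  then show "\<bar>det (mat_delete M i j)\<bar> \<le> k * (2 * k - 1) * (2 * k + 1)"
    using abs_minor_le_minus[OF k] M ij by blast
next
  show "extremal_minus k \<in> carrier_mat 4 4 \<and> unimodular (extremal_minus k)
      \<and> max_norm (extremal_minus k) = k"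
    using extremal_minus(1-4)[OF k] by fastforce
qed (use extremal_minus(5)[OF k] in auto)

theorem mainTheorem1:
  fixes k :: int
  assumes "k \<ge> 2"
  shows
    "(\<forall>M \<in> carrier_mat 4 4. unimodular M \<and> elements_mat M \<subseteq> {0..k} \<longrightarrow>
        (\<forall>i<4. \<forall>j<4. \<bar>det (mat_delete M i j)\<bar> \<le> beta_plus k))
     \<and> beta_plus k = k * (2 * k^2 - 2 * k + 1)
     \<and> k * (2 * k^2 - 2 * k + 1) = 2 * k^3 - 2 * k^2 + k
     \<and> (\<exists>M \<in> carrier_mat 4 4. unimodular M \<and> elements_mat M \<subseteq> {0..k} \<and>
        (\<exists>i<4. \<exists>j<4. \<bar>det (mat_delete M i j)\<bar> = beta_plus k))
     \<and> (\<forall>M \<in> carrier_mat 4 4. unimodular M \<and> elements_mat M \<subseteq> {-k..k} \<longrightarrow>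
        (\<forall>i<4. \<forall>j<4. \<bar>det (mat_delete M i j)\<bar> \<le> beta_minus k))
     \<and> beta_minus k = k * (2 * k - 1) * (2 * k + 1)
     \<and> k * (2 * k - 1) * (2 * k + 1) = 4 * k^3 - k
     \<and> (\<exists>M \<in> carrier_mat 4 4. unimodular M \<and> elements_mat M \<subseteq> {-k..k} \<and>
        (\<exists>i<4. \<exists>j<4. \<bar>det (mat_delete M i j)\<bar> = beta_minus k))"
proof (intro conjI ballI allI impI)
  fix M i j
  assume "M \<in> carrier_mat 4 4" "unimodular M \<and> elements_mat M \<subseteq> {0..k}" "i < (4::nat)" "j < (4::nat)"
  then show "\<bar>det (mat_delete M i j)\<bar> \<le> beta_plus k"
    using abs_minor_le_plus[OF assms] by (simp add: beta_plus_eq[OF assms])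
next
  fix M i j
  assume "M \<in> carrier_mat 4 4" "unimodular M \<and> elements_mat M \<subseteq> {-k..k}" "i < (4::nat)" "j < (4::nat)"
  then show "\<bar>det (mat_delete M i j)\<bar> \<le> beta_minus k"
    using abs_minor_le_minus[OF assms] by (simp add: beta_minus_eq[OF assms])
next
  have "(3::nat) < 4" by simp
  then show "\<exists>M \<in> carrier_mat 4 4. unimodular M \<and> elements_mat M \<subseteq> {0..k} \<and>
      (\<exists>i<4. \<exists>j<4. \<bar>det (mat_delete M i j)\<bar> = beta_plus k)"
    using extremal_plus[OF assms] beta_plus_eq[OF assms] by metis
next
  have "(3::nat) < 4" by simp
  then show "\<exists>M \<in> carrier_mat 4 4. unimodular M \<and> elements_mat M \<subseteq> {-k..k} \<and>
      (\<exists>i<4. \<exists>j<4. \<bar>det (mat_delete M i j)\<bar> = beta_minus k)"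
    using extremal_minus[OF assms] beta_minus_eq[OF assms] by metis
qed (simp_all add: beta_plus_eq[OF assms] beta_minus_eq[OF assms] algebra_simps
    power2_eq_square power3_eq_cube)

end
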